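(* Let $\lambda\in\mathbb{R}$, $x\in\mathbb{R}$, and let $r\ge1$ be an integer. For every integer $n\ge0$, $$\beta_{n,\lambda}^{(r)}(x)=\sum_{m=0}^{n}D_{m,\lambda}^{(r)}(x)\,S_2(n,m).$$
   Context: All generating functions are formal power series in $t$. For $\lambda,y\in\mathbb{R}$, set $(y)_{0,\lambda}=1$ and $(y)_{n,\lambda}=y(y-\lambda)\cdots(y-(n-1)\lambda)$ for $n\ge1$; the formal power series $(1+\lambda u)^{y/\lambda}$ means $\sum_{n\ge0}(y)_{n,\lambda}\frac{u^n}{n!}$ (the usual binomial series for $\lambda\ne0$, and the limit $e^{yu}$ for $\lambda=0$). The higher-order degenerate Bernoulli polynomials $\beta_{n,\lambda}^{(r)}(x)$ (Carlitz) are defined by $\left(\frac{t}{(1+\lambda t)^{1/\lambda}-1}\right)^r(1+\lambda t)^{x/\lambda}=\sum_{n=0}^\infty\beta_{n,\lambda}^{(r)}(x)\frac{t^n}{n!}$. The higher-order degenerate Daehee polynomials of the second kind $D_{n,\lambda}^{(r)}(x)$ are defined by $\left(\frac{\log(1+t)}{(1+\lambda\log(1+t))^{1/\lambda}-1}\right)^r(1+\lambda\log(1+t))^{x/\lambda}=\sum_{n=0}^\infty D_{n,\lambda}^{(r)}(x)\frac{t^n}{n!}$. $S_2(n,l)$ are the Stirling numbers of the second kind: $x^n=\sum_{l=0}^n S_2(n,l)(x)_l$, where $(x)_0=1$ and $(x)_l=x(x-1)\cdots(x-l+1)$ for $l\ge1$. *)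

theory Defs
  imports "HOL-Computational_Algebra.Formal_Power_Series" "HOL-Combinatorics.Stirling"
begin

definition degen_ffact :: "real \<Rightarrow> real \<Rightarrow> nat \<Rightarrow> real" where
  "degen_ffact lam y n = (\<Prod>i<n. y - of_nat i * lam)"

text \<open>The formal power series \<open>(1 + \<lambda> u)\<^bsup>y/\<lambda>\<^esup>\<close> in \<open>u\<close>.\<close>

definition fps_degen_exp :: "real \<Rightarrow> real \<Rightarrow> real fps" where
  "fps_degen_exp lam y = Abs_fps (\<lambda>n. degen_ffact lam y n / fact n)"

lemma fps_degen_exp_0: "fps_degen_exp 0 y = fps_exp y"
  by (simp add: fps_eq_iff fps_degen_exp_def degen_ffact_def)

lemma fps_degen_exp_nonzero:
  assumes "lam \<noteq> 0"
  shows "fps_degen_exp lam y = fps_binomial (y / lam) oo (fps_const lam * fps_X)"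
proof -
  have "degen_ffact lam y n = lam ^ n * (\<Prod>i<n. y / lam - of_nat i)" for n
    using assms by (induction n) (auto simp: degen_ffact_def field_simps)
  then show ?thesis
    by (simp add: fps_eq_iff fps_degen_exp_def fps_compose_linear gbinomial_prod_rev
        lessThan_atLeast0)
qed

text \<open>
  The quotients below are those of the library's division of power series over a field. Numerator
  and denominator both have order exactly 1, so the quotient is an honest power series and not a
  junk value of the total division operation. The series \<open>log (1 + t)\<close> is \<open>fps_ln 1\<close>.
\<close>

lemma subdegree_fps_degen_exp: "subdegree (fps_degen_exp lam 1 - 1) = 1"
  by (rule subdegreeI) (auto simp: fps_degen_exp_def degen_ffact_def)

lemma subdegree_fps_ln: "subdegree (fps_ln 1 :: real fps) = 1"
  by (rule subdegreeI) (auto simp: fps_ln_nth)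

lemma subdegree_fps_degen_exp_ln:
  "subdegree ((fps_degen_exp lam 1 oo fps_ln 1) - 1) = 1"
  by (rule subdegreeI)
    (auto simp: fps_degen_exp_def degen_ffact_def fps_compose_nth fps_ln_nth)

definition degen_Bernoulli :: "real \<Rightarrow> nat \<Rightarrow> nat \<Rightarrow> real \<Rightarrow> real" where
  "degen_Bernoulli lam r n x =
     fact n * fps_nth ((fps_X / (fps_degen_exp lam 1 - 1)) ^ r * fps_degen_exp lam x) n"

definition degen_Daehee2 :: "real \<Rightarrow> nat \<Rightarrow> nat \<Rightarrow> real \<Rightarrow> real" where
  "degen_Daehee2 lam r n x =
     fact n * fps_nth
       ((fps_ln 1 / ((fps_degen_exp lam 1 oo fps_ln 1) - 1)) ^ r
          * (fps_degen_exp lam x oo fps_ln 1)) n"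

text \<open>
  The library defines \<open>Stirling\<close> by its recurrence; these numbers are the connection coefficients
  from powers to falling factorials, and they are determined by that property.
\<close>

lemma power_eq_sum_Stirling:
  "x ^ n = (\<Sum>l=0..n. real (Stirling n l) * degen_ffact 1 x l)"
proof (induction n)
  case 0
  show ?case by (simp add: degen_ffact_def)
next
  case (Suc n)
  let ?F = "degen_ffact 1 x"
  have F: "x * ?F l = ?F (Suc l) + real l * ?F l" for l
    by (simp add: degen_ffact_def algebra_simps)
  have "x ^ Suc n = (\<Sum>l=0..n. real (Stirling n l) * (x * ?F l))"
    by (simp add: Suc sum_distrib_left mult_ac)
  also have "\<dots> = (\<Sum>l=0..n. real (Stirling n l) * ?F (Suc l))
      + (\<Sum>l=0..n. real l * real (Stirling n l) * ?F l)"
    unfolding F by (simp add: algebra_simps sum.distrib)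
  also have "(\<Sum>l=0..n. real l * real (Stirling n l) * ?F l)
      = (\<Sum>l=0..Suc n. real l * real (Stirling n l) * ?F l)"
    by simp
  also have "\<dots> = (\<Sum>l=0..n. real (Suc l) * real (Stirling n (Suc l)) * ?F (Suc l))"
    by (subst sum.atLeast0_atMost_Suc_shift) simp
  also have "(\<Sum>l=0..n. real (Stirling n l) * ?F (Suc l)) + \<dots>
      = (\<Sum>l=0..n. real (Stirling (Suc n) (Suc l)) * ?F (Suc l))"
    by (simp add: algebra_simps flip: sum.distrib)
  also have "\<dots> = (\<Sum>l=0..Suc n. real (Stirling (Suc n) l) * ?F l)"
    by (subst sum.atLeast0_atMost_Suc_shift) simp
  finally show ?case .
qed

lemma degen_ffact_independent:
  assumes "\<And>x. (\<Sum>l=0..n. a l * degen_ffact 1 x l) = 0" and "l \<le> n"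
  shows "a l = 0"
  using \<open>l \<le> n\<close>
proof (induction l rule: less_induct)
  case (less l)
  have "degen_ffact 1 (real l) k = 0" if "k > l" for k
    using that by (auto simp: degen_ffact_def)
  then have "(\<Sum>k=0..n. a k * degen_ffact 1 (real l) k)
      = (\<Sum>k\<in>{l}. a k * degen_ffact 1 (real l) k)"
    using less by (intro sum.mono_neutral_right) (auto, metis nat_neq_iff)
  moreover have "degen_ffact 1 (real l) l \<noteq> 0"
    by (auto simp: degen_ffact_def)
  ultimately show ?case
    using assms(1)[of "real l"] by simp
qed

lemma Stirling_unique:
  assumes "\<And>x. x ^ n = (\<Sum>l=0..n. a l * degen_ffact 1 x l)" and "l \<le> n"
  shows "a l = real (Stirling n l)"
proof -
  have "(\<Sum>l=0..n. (a l - real (Stirling n l)) * degen_ffact 1 x l) = 0" for x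
    using assms(1)[of x] power_eq_sum_Stirling[of x n]
    by (simp add: algebra_simps sum_subtractf)
  from degen_ffact_independent[OF this assms(2)] show ?thesis by simp
qed

end

theory Submission
  imports Defs
begin

text \<open>
  Substituting \<open>log (1 + t)\<close> for \<open>t\<close> turns the generating function of the degenerate Bernoulli
  polynomials into that of the degenerate Daehee polynomials of the second kind. Substituting back
  \<open>e\<^sup>t - 1\<close>, whose powers generate the Stirling numbers of the second kind, gives the identity.
\<close>

text \<open>Differentiating \<open>(fps_exp 1 - 1) ^ m\<close> turns into the recurrence of
  \<open>Stirling\<close> on coefficients; it involves both \<open>m\<close> and its predecessor, so
  the induction on \<open>n\<close> keeps \<open>m\<close> arbitrary.\<close>

lemma fps_exp_minus_1_power_nth:
  "fps_nth ((fps_exp 1 - 1) ^ m) n = (fact m * of_nat (Stirling n m) / fact n :: 'a::field_char_0)"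
proof (induction n arbitrary: m)
  case 0
  show ?case by (cases m) simp_all
next
  case (Suc n)
  let ?E = "fps_exp 1 - 1 :: 'a fps"
  show ?case
  proof (cases m)
    case 0
    then show ?thesis by simp
  next
    case (Suc k)
    \<comment> \<open>The derivative of \<open>?E\<close> is \<open>?E + 1\<close>.\<close>
    have "fps_deriv (?E ^ Suc k) = fps_const (of_nat (Suc k)) * (?E ^ Suc k + ?E ^ k)"
      unfolding fps_deriv_power by (simp add: left_diff_distrib)
    then have "fps_nth (fps_deriv (?E ^ Suc k)) n
        = of_nat (Suc k) * (fps_nth (?E ^ Suc k) n + fps_nth (?E ^ k) n)"
      by (simp only: fps_mult_left_const_nth fps_add_nth)
    then have "of_nat (Suc n) * fps_nth (?E ^ Suc k) (Suc n)
        = of_nat (Suc k) * (fps_nth (?E ^ Suc k) n + fps_nth (?E ^ k) n)"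
      by (simp only: fps_deriv_nth Suc_eq_plus1)
    also have "\<dots> = fact (Suc k) * of_nat (Stirling (Suc n) (Suc k)) / fact n"
      unfolding Suc.IH by (simp add: field_simps)
    finally show ?thesis
      unfolding Suc by (simp add: field_simps del: of_nat_Suc)
  qed
qed

lemma fps_compose_exp_minus_1_nth:
  fixes f :: "'a::field_char_0 fps"
  shows "fact n * fps_nth (f oo (fps_exp 1 - 1)) n
    = (\<Sum>m=0..n. fact m * fps_nth f m * of_nat (Stirling n m))"
  by (simp add: fps_compose_nth fps_exp_minus_1_power_nth sum_distrib_left mult_ac)

lemma fps_ln_compose_exp_minus_1: "fps_ln 1 oo (fps_exp 1 - 1) = (fps_X :: 'a::field_char_0 fps)"
  by (simp add: fps_ln_fps_exp_inv fps_inv)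

theorem theorem2p8:
  fixes lam x :: real and r n :: nat
  assumes "r \<ge> 1"
  shows "degen_Bernoulli lam r n x
    = (\<Sum>m=0..n. degen_Daehee2 lam r m x * real (Stirling n m))"
proof -
  define B where "B = (fps_X / (fps_degen_exp lam 1 - 1)) ^ r * fps_degen_exp lam x"
  \<comment> \<open>Composition distributes over a quotient only if the division is exact, which
    holds here since both series have order 1, and the composed denominator is nonzero, which
    follows from its order being 1.\<close>
  have "fps_degen_exp lam 1 - 1 dvd (fps_X :: real fps)"
    using subdegree_fps_degen_exp[of lam] by (subst fps_dvd_iff) auto
  then have "(fps_ln 1 / ((fps_degen_exp lam 1 oo fps_ln 1) - 1)) ^ r
      * (fps_degen_exp lam x oo fps_ln 1) = B oo fps_ln 1"
    using subdegree_fps_degen_exp_ln[of lam] unfolding B_def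
    by (subst fps_compose_mult_distrib, simp, subst fps_compose_power[symmetric], simp,
        subst fps_compose_divide_distrib) (auto simp: fps_compose_sub_distrib)
  then have D: "degen_Daehee2 lam r m x = fact m * fps_nth (B oo fps_ln 1) m" for m
    by (simp add: degen_Daehee2_def)
  have "B = (B oo fps_ln 1) oo (fps_exp 1 - 1)"
    by (simp add: fps_ln_compose_exp_minus_1 flip: fps_compose_assoc)
  then show ?thesis
    unfolding D degen_Bernoulli_def B_def[symmetric]
    by (metis fps_compose_exp_minus_1_nth)
qed

end
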